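(* Let $m\ge1$, $k\ge 1$, and let $L$ be a homogeneous Lagrangian on the bundle $\mathcal{F}^k_{(m)}E$ of $k$-th order $m$-frames of a smooth manifold $E$. Let $\Theta_0$ be the class of $L\,d^mt$ and $\Theta_1=Pd\Theta_0$. Then $$\Theta_0=\frac1m\,i_{\mathrm T}\Theta_1 .$$
   Context: $E$ is a smooth manifold of dimension $n$. For $k\ge1$, $\mathcal{F}^k_{(m)}E$ is the manifold of $k$-jets at $0$ of maps $\gamma$ from a neighbourhood of $0\in\mathbb{R}^m$ to $E$ which are immersions at $0$ (the bundle of $k$-th order $m$-frames, or regular $k$-th order $m$-velocities); $\tau_{k+1,k}:\mathcal{F}^{k+1}_{(m)}E\to\mathcal{F}^k_{(m)}E$ is the projection. Local coordinates $(u^\alpha)$ on $E$ give coordinates $u^\alpha_I$, $0\le|I|\le k$, on $\mathcal{F}^k_{(m)}E$, where $u^\alpha_I$ is the partial derivative $\partial^{|I|}\gamma^\alpha/\partial t^I$ at $0$. Here $I\in\mathbb{N}^m$ is a multi-index with entries $I(i)$, $|I|=\sum_i I(i)$, $I!=\prod_i I(i)!$, and $1_j$ is the multi-index with $1$ in position $j$ and $0$ elsewhere. Repeated indices are summed. Pull-backs by the projections between frame bundles are omitted: forms are identified with their pull-backs. Total derivatives: $\mathrm{T}_j=\sum_{|I|=0}^k u^\alpha_{I+1_j}\,\partial/\partial u^\alpha_I$, a vector field along $\tau_{k+1,k}$. For a form $\phi$ on $\mathcal{F}^k_{(m)}E$, $i_j\phi$ is its contraction with $\mathrm{T}_j$ and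 $d_j\phi=i_jd\phi+d\,i_j\phi$ its Lie derivative; both are forms on $\mathcal{F}^{k+1}_{(m)}E$. The $d_j$ commute, and $d_I$ denotes the iterated operator. Vertical endomorphisms: $S^i=\sum_{|I|=0}^{k-1}(I(i)+1)\,\frac{\partial}{\partial u^\alpha_{I+1_i}}\otimes du^\alpha_I$ is a type $(1,1)$ tensor field on $\mathcal{F}^k_{(m)}E$. $S^i$ also denotes the contraction with forms, i.e. the degree-$0$ derivation which is zero on functions and satisfies $(S^i\phi)(X_1,\ldots,X_r)=\sum_a\phi(X_1,\ldots,S^iX_a,\ldots,X_r)$. The $S^i$ commute, and $S^I$ acting on forms is the iterated contraction. Fundamental vector fields: for $|K|\ge1$, $\Delta^K_j=S^K(\mathrm{T}_j)$ (with $S^K$ the composite tensor field), in coordinates $\Delta^K_j=\sum_{|I|=0}^{k-|K|}\frac{(I+K)!}{I!}u^\alpha_{I+1_j}\,\partial/\partial u^\alpha_{I+K}$ on $\mathcal{F}^k_{(m)}E$; $d^K_j$ is the Lie derivative along $\Delta^K_j$, with $d^i_j=d^{1_i}_j$. A Lagrangian is a smooth function $L$ on $\mathcal{F}^k_{(m)}E$. It is homogeneous if $d^i_jL=\delta^i_jL$ for all $i,j$ and $d^I_jL=0$ for all $j$ and all $|I|\ge2$. Vector-valued forms: $\Omega^{r,s}_k=\Omega^r(\mathcal{F}^k_{(m)}E)\otimes\bigwedge^s\mathbb{R}^{m*}$. With $(dt^i)$ the standard basis of $\mathbb{R}^{m*}$, an element is written $\Phi=\phi_{i_1\cdots i_s}\otimes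 dt^{i_1}\wedge\cdots\wedge dt^{i_s}$ with scalar $r$-forms $\phi_{i_1\cdots i_s}$ completely skew in their indices. $\overline{\Omega}^{0,s}_k$ is the quotient of $\Omega^{0,s}_k$ by the constant functions. Put $d^mt=dt^1\wedge\cdots\wedge dt^m$. The operator $d$ acts componentwise (and is well defined on $\overline{\Omega}^{0,s}_k$), and $i_{\mathrm T}\Phi=(i_j\phi_{i_1\cdots i_s})\otimes dt^j\wedge dt^{i_1}\wedge\cdots\wedge dt^{i_s}$. The operator $P$ on $\Omega^{r,s}_k$ ($r\ge1$), with values in $\Omega^{r,s-1}_{(r+1)k-1}$, is $$P\Phi=P^j_{(s)}(\phi_{i_1\cdots i_s})\otimes\Big\{\tfrac{\partial}{\partial t^j}\lrcorner\,(dt^{i_1}\wedge\cdots\wedge dt^{i_s})\Big\},\qquad P^j_{(s)}=\sum_{|J|=0}^{rk-1}\frac{(-1)^{|J|}(m-s)!\,|J|!}{r^{|J|+1}(m-s+|J|+1)!\,J!}\,d_JS^{J+1_j},$$ where $\lrcorner$ denotes contraction. $\Theta_0\in\overline{\Omega}^{0,m}_k$ is the class of $L\,d^mt$; an equality between $\Theta_0$ and a vector-valued function is understood in the quotient by constant functions. $\Theta_1$ is a vector-valued $1$-form with values in $\bigwedge^{m-1}\mathbb{R}^{m*}$. *)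

theory Defs
  imports "HOL-Analysis.Analysis" "HOL-Combinatorics.Permutations"
begin

subsection \<open>Multi-indices\<close>

text \<open>The index type \<open>'m\<close> stands for \<open>{1,\<dots>,m}\<close>, so that \<open>m = CARD('m)\<close>; its linear order is
  used for \<open>dt\<^sup>1 \<and> \<dots> \<and> dt\<^sup>m\<close> and for the order of composition in iterated operators. The
  multi-index \<open>1\<^sub>j\<close> is \<open>axis j 1\<close>.\<close>

type_synonym 'm mindex = "nat ^ 'm"

type_synonym 'm rvec = "real ^ 'm"

definition mlen :: "'m::finite mindex \<Rightarrow> nat"
  where "mlen I = (\<Sum>i\<in>UNIV. I $ i)"

definition mfact :: "'m::finite mindex \<Rightarrow> nat"
  where "mfact I = (\<Prod>i\<in>UNIV. fact (I $ i))"

text \<open>The list in which each \<open>i\<close> occurs \<open>I(i)\<close> times: \<open>d\<^sub>I\<close> and \<open>S\<^sup>I\<close> are composed along it.\<close>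

definition mword :: "'m::{finite,linorder} mindex \<Rightarrow> 'm list"
  where "mword I = concat (map (\<lambda>i. replicate (I $ i) i) (sorted_list_of_set UNIV))"


subsection \<open>Smooth manifolds, immersions and jets\<close>

primrec Ck_on :: "'a::euclidean_space set \<Rightarrow> ('a \<Rightarrow> 'b::euclidean_space) \<Rightarrow> nat \<Rightarrow> bool"
  where
    "Ck_on S f 0 \<longleftrightarrow> continuous_on S f"
  | "Ck_on S f (Suc p) \<longleftrightarrow> (\<forall>x\<in>S. f differentiable (at x)) \<and>
       (\<forall>v. Ck_on S (\<lambda>x. frechet_derivative f (at x) v) p)"

text \<open>Only used for open \<open>S\<close>.\<close>

definition smooth_on :: "'a::euclidean_space set \<Rightarrow> ('a \<Rightarrow> 'b::euclidean_space) \<Rightarrow> bool"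
  where "smooth_on S f \<longleftrightarrow> (\<forall>p. Ck_on S f p)"

type_synonym ('e, 'n) chart = "'e set \<times> ('e \<Rightarrow> real ^ 'n)"

text \<open>A smooth manifold of dimension \<open>CARD('n)\<close>, with underlying space \<open>X\<close> and smooth atlas \<open>A\<close>
  (not necessarily maximal).\<close>

definition smooth_manifold :: "'e topology \<Rightarrow> ('e, 'n::finite) chart set \<Rightarrow> bool"
  where "smooth_manifold X A \<longleftrightarrow>
    Hausdorff_space X \<and> second_countable X \<and>
    (\<Union>c\<in>A. fst c) = topspace X \<and>
    (\<forall>c\<in>A. openin X (fst c) \<and> open (snd c ` fst c) \<and>
       homeomorphic_map (subtopology X (fst c)) (top_of_set (snd c ` fst c)) (snd c)) \<and>
    (\<forall>c\<in>A. \<forall>c'\<in>A. smooth_on (snd c ` (fst c \<inter> fst c')) (snd c' \<circ> inv_into (fst c) (snd c)))"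

text \<open>A map from a neighbourhood of \<open>0\<close> is represented by a total function, whose values away
  from \<open>0\<close> are irrelevant.\<close>

definition immersion_at_0 ::
    "'e topology \<Rightarrow> ('e, 'n::finite) chart set \<Rightarrow> ('m::finite rvec \<Rightarrow> 'e) \<Rightarrow> bool"
  where "immersion_at_0 X A \<gamma> \<longleftrightarrow>
    (\<exists>W. open W \<and> 0 \<in> W \<and> continuous_map (top_of_set W) X \<gamma> \<and>
       (\<forall>c\<in>A. smooth_on {t \<in> W. \<gamma> t \<in> fst c} (snd c \<circ> \<gamma>))) \<and>
    (\<forall>c\<in>A. \<gamma> 0 \<in> fst c \<longrightarrow> inj (frechet_derivative (snd c \<circ> \<gamma>) (at 0)))"

definition partial_t :: "'m::finite \<Rightarrow> ('m rvec \<Rightarrow> real ^ 'n::finite) \<Rightarrow> 'm rvec \<Rightarrow> real ^ 'n"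
  where "partial_t i f = (\<lambda>t. frechet_derivative f (at t) (axis i 1))"

definition partials ::
    "'m::{finite,linorder} mindex \<Rightarrow> ('m rvec \<Rightarrow> real ^ 'n::finite) \<Rightarrow> 'm rvec \<Rightarrow> real ^ 'n"
  where "partials I f = foldr partial_t (mword I) f"

text \<open>A point with coordinates \<open>u\<^sup>\<alpha>\<^sub>I\<close> is a function \<open>u\<close> with \<open>u I $ \<alpha> = u\<^sup>\<alpha>\<^sub>I\<close>. Coordinates of all
  orders are kept, and objects of order \<open>k\<close> depend only on the \<open>u I\<close> with \<open>mlen I \<le> k\<close>. Thus
  the pull-backs by \<open>\<tau>\<^bsub>k+1,k\<^esub>\<close> become identities. The same type serves for the components of tangent
  vectors.\<close>

type_synonym ('m, 'n) coords = "'m mindex \<Rightarrow> real ^ 'n"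

definition jet_coords ::
    "('e, 'n::finite) chart \<Rightarrow> ('m::{finite,linorder} rvec \<Rightarrow> 'e) \<Rightarrow> ('m, 'n) coords"
  where "jet_coords c \<gamma> = (\<lambda>I. partials I (snd c \<circ> \<gamma>) 0)"

definition jet ::
    "'e topology \<Rightarrow> ('e, 'n::finite) chart set \<Rightarrow> nat \<Rightarrow>
     ('m::{finite,linorder} rvec \<Rightarrow> 'e) \<Rightarrow> ('m rvec \<Rightarrow> 'e) set"
  where "jet X A k \<gamma> = {\<delta>. immersion_at_0 X A \<delta> \<and> \<delta> 0 = \<gamma> 0 \<and>
     (\<forall>c\<in>A. \<gamma> 0 \<in> fst c \<longrightarrow> (\<forall>I. mlen I \<le> k \<longrightarrow> jet_coords c \<delta> I = jet_coords c \<gamma> I))}"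

definition frame_bundle ::
    "'e topology \<Rightarrow> ('e, 'n::finite) chart set \<Rightarrow> nat \<Rightarrow>
     ('m::{finite,linorder} rvec \<Rightarrow> 'e) set set"
  where "frame_bundle X A k = {jet X A k \<gamma> | \<gamma>. immersion_at_0 X A \<gamma>}"

text \<open>The range of the coordinates on the part of the frame bundles lying over the chart domain;
  the condition on the \<open>u\<^bsub>1\<^sub>i\<^esub>\<close> is that of an immersion, so that it is the same for every \<open>k \<ge> 1\<close>.\<close>

definition coord_dom :: "('e, 'n::finite) chart \<Rightarrow> ('m::finite, 'n) coords set"
  where "coord_dom c = {u. u 0 \<in> snd c ` fst c \<and>
     inj (\<lambda>a::'m rvec. \<Sum>i\<in>UNIV. a $ i *\<^sub>R u (axis i 1))}"

definition frame_at ::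
    "'e topology \<Rightarrow> ('e, 'n::finite) chart set \<Rightarrow> nat \<Rightarrow> ('e, 'n) chart \<Rightarrow>
     ('m::{finite,linorder}, 'n) coords \<Rightarrow> ('m rvec \<Rightarrow> 'e) set"
  where "frame_at X A k c u = (THE p. p \<in> frame_bundle X A k \<and>
     (\<exists>\<gamma>\<in>p. \<gamma> 0 \<in> fst c \<and> (\<forall>I. mlen I \<le> k \<longrightarrow> jet_coords c \<gamma> I = u I)))"

text \<open>The coordinate expression, in the chart \<open>c\<close>, of a function on the bundle of order \<open>k\<close>.\<close>

definition coord_expr ::
    "'e topology \<Rightarrow> ('e, 'n::finite) chart set \<Rightarrow> nat \<Rightarrow>
     (('m::{finite,linorder} rvec \<Rightarrow> 'e) set \<Rightarrow> real) \<Rightarrow> ('e, 'n) chart \<Rightarrow> ('m, 'n) coords \<Rightarrow> real"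
  where "coord_expr X A k f c = (\<lambda>u. f (frame_at X A k c u))"

definition coord_line :: "'m mindex \<Rightarrow> 'n \<Rightarrow> ('m::finite, 'n::finite) coords \<Rightarrow> real \<Rightarrow> ('m, 'n) coords"
  where "coord_line I \<alpha> u = (\<lambda>x. u(I := u I + x *\<^sub>R axis \<alpha> 1))"

text \<open>\<open>\<partial>g/\<partial>u\<^sup>\<alpha>\<^sub>I\<close>\<close>

definition pderiv_coord ::
    "'m mindex \<Rightarrow> 'n \<Rightarrow> (('m::finite, 'n::finite) coords \<Rightarrow> real) \<Rightarrow> ('m, 'n) coords \<Rightarrow> real"
  where "pderiv_coord I \<alpha> g u = deriv (\<lambda>x. g (coord_line I \<alpha> u x)) 0"

text \<open>The topology on coordinates is the product topology; for a function of the finitely many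
  coordinates of order at most \<open>k\<close>, continuity is therefore the usual notion.\<close>

primrec Ck_coords ::
    "('m::finite, 'n::finite) coords set \<Rightarrow> (('m, 'n) coords \<Rightarrow> real) \<Rightarrow> nat \<Rightarrow> bool"
  where
    "Ck_coords D g 0 \<longleftrightarrow> continuous_on D g"
  | "Ck_coords D g (Suc p) \<longleftrightarrow> continuous_on D g \<and>
       (\<forall>I \<alpha>. (\<forall>u\<in>D. (\<lambda>x. g (coord_line I \<alpha> u x)) differentiable (at 0)) \<and>
              Ck_coords D (pderiv_coord I \<alpha> g) p)"

definition lagrangian ::
    "'e topology \<Rightarrow> ('e, 'n::finite) chart set \<Rightarrow> nat \<Rightarrow>
     (('m::{finite,linorder} rvec \<Rightarrow> 'e) set \<Rightarrow> real) \<Rightarrow> bool"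
  where "lagrangian X A k L \<longleftrightarrow> (\<forall>c\<in>A. \<forall>p. Ck_coords (coord_dom c) (coord_expr X A k L c) p)"


subsection \<open>Scalar forms in coordinates\<close>

text \<open>\<open>\<phi> u vs\<close> is the value at \<open>u\<close> of the form \<open>\<phi>\<close> on the list \<open>vs\<close> of tangent vectors. A form of
  degree \<open>r\<close> vanishes on lists of length other than \<open>r\<close>, so that degrees need not be passed to the
  operators. The argument \<open>k\<close> of an operator is the order of the bundle on which its argument
  lives.\<close>

type_synonym ('m, 'n) form = "('m, 'n) coords \<Rightarrow> ('m, 'n) coords list \<Rightarrow> real"

definition form_of_fun :: "(('m, 'n) coords \<Rightarrow> real) \<Rightarrow> ('m, 'n) form"
  where "form_of_fun g = (\<lambda>u vs. if vs = [] then g u else 0)"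

definition vec_apply ::
    "nat \<Rightarrow> ('m::finite, 'n::finite) coords \<Rightarrow> (('m, 'n) coords \<Rightarrow> real) \<Rightarrow> ('m, 'n) coords \<Rightarrow> real"
  where "vec_apply k v g u =
    (\<Sum>I | mlen I \<le> k. \<Sum>\<alpha>\<in>UNIV. v I $ \<alpha> * pderiv_coord I \<alpha> g u)"

text \<open>The exterior derivative, evaluated on coordinate vector fields with constant
  coefficients (whose brackets vanish).\<close>

definition ext_d :: "nat \<Rightarrow> ('m::finite, 'n::finite) form \<Rightarrow> ('m, 'n) form"
  where "ext_d k \<phi> = (\<lambda>u vs. \<Sum>a<length vs. (-1) ^ a *
     vec_apply k (vs ! a) (\<lambda>w. \<phi> w (take a vs @ drop (Suc a) vs)) u)"

definition contract :: "(('m, 'n) coords \<Rightarrow> ('m, 'n) coords) \<Rightarrow> ('m, 'n) form \<Rightarrow> ('m, 'n) form"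
  where "contract Y \<phi> = (\<lambda>u vs. \<phi> u (Y u # vs))"

definition lie_d ::
    "nat \<Rightarrow> (('m::finite, 'n::finite) coords \<Rightarrow> ('m, 'n) coords) \<Rightarrow> ('m, 'n) form \<Rightarrow> ('m, 'n) form"
  where "lie_d k Y \<phi> = (\<lambda>u vs. contract Y (ext_d k \<phi>) u vs + ext_d k (contract Y \<phi>) u vs)"

text \<open>\<open>T\<^sub>j\<close> along \<open>\<tau>\<^bsub>k+1,k\<^esub>\<close>\<close>

definition total_vec :: "nat \<Rightarrow> 'm \<Rightarrow> ('m::finite, 'n::finite) coords \<Rightarrow> ('m, 'n) coords"
  where "total_vec k j u = (\<lambda>I. if mlen I \<le> k then u (I + axis j 1) else 0)"

definition i_total :: "nat \<Rightarrow> 'm \<Rightarrow> ('m::finite, 'n::finite) form \<Rightarrow> ('m, 'n) form"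
  where "i_total k j = contract (total_vec k j)"

definition d_total :: "nat \<Rightarrow> 'm \<Rightarrow> ('m::finite, 'n::finite) form \<Rightarrow> ('m, 'n) form"
  where "d_total k j \<phi> =
    (\<lambda>u vs. i_total k j (ext_d k \<phi>) u vs + ext_d (Suc k) (i_total k j \<phi>) u vs)"

primrec d_total_list :: "nat \<Rightarrow> 'm list \<Rightarrow> ('m::finite, 'n::finite) form \<Rightarrow> ('m, 'n) form"
  where
    "d_total_list k [] \<phi> = \<phi>"
  | "d_total_list k (j # js) \<phi> = d_total (k + length js) j (d_total_list k js \<phi>)"

definition d_multi ::
    "nat \<Rightarrow> 'm mindex \<Rightarrow> ('m::{finite,linorder}, 'n::finite) form \<Rightarrow> ('m, 'n) form"
  where "d_multi k J = d_total_list k (mword J)"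

definition S_vec :: "nat \<Rightarrow> 'm \<Rightarrow> ('m::finite, 'n::finite) coords \<Rightarrow> ('m, 'n) coords"
  where "S_vec k i v = (\<lambda>J. \<Sum>I | mlen I < k \<and> I + axis i 1 = J. real (I $ i + 1) *\<^sub>R v I)"

definition S_form :: "nat \<Rightarrow> 'm \<Rightarrow> ('m::finite, 'n::finite) form \<Rightarrow> ('m, 'n) form"
  where "S_form k i \<phi> = (\<lambda>u vs. \<Sum>a<length vs. \<phi> u (vs[a := S_vec k i (vs ! a)]))"

definition S_vec_multi ::
    "nat \<Rightarrow> 'm mindex \<Rightarrow> ('m::{finite,linorder}, 'n::finite) coords \<Rightarrow> ('m, 'n) coords"
  where "S_vec_multi k K = foldr (S_vec k) (mword K)"

definition S_multi ::
    "nat \<Rightarrow> 'm mindex \<Rightarrow> ('m::{finite,linorder}, 'n::finite) form \<Rightarrow> ('m, 'n) form"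
  where "S_multi k K = foldr (S_form k) (mword K)"

text \<open>\<open>\<Delta>\<^sup>K\<^sub>j = S\<^sup>K(T\<^sub>j)\<close>, for \<open>|K| \<ge> 1\<close>. As \<open>S\<^sup>K\<close> shifts orders upwards, only the \<open>u I\<close> with
  \<open>mlen I \<le> k\<close> contribute.\<close>

definition Delta ::
    "nat \<Rightarrow> 'm mindex \<Rightarrow> 'm \<Rightarrow> ('m::{finite,linorder}, 'n::finite) coords \<Rightarrow> ('m, 'n) coords"
  where "Delta k K j = (\<lambda>u. S_vec_multi k K (total_vec k j u))"

definition homogeneous ::
    "'e topology \<Rightarrow> ('e, 'n::finite) chart set \<Rightarrow> nat \<Rightarrow>
     (('m::{finite,linorder} rvec \<Rightarrow> 'e) set \<Rightarrow> real) \<Rightarrow> bool"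
  where "homogeneous X A k L \<longleftrightarrow> (\<forall>c\<in>A. \<forall>u\<in>coord_dom c.
     (\<forall>i j. lie_d k (Delta k (axis i 1) j) (form_of_fun (coord_expr X A k L c)) u [] =
        (if i = j then coord_expr X A k L c u else 0)) \<and>
     (\<forall>I j. 2 \<le> mlen I \<longrightarrow>
        lie_d k (Delta k I j) (form_of_fun (coord_expr X A k L c)) u [] = 0))"


subsection \<open>Vector-valued forms\<close>

text \<open>An element of \<open>\<Lambda>\<^sup>s \<real>\<^sup>m\<^sup>*\<close> is an alternating multilinear function of lists of \<open>s\<close> vectors; here
  is \<open>dt\<^bsup>i\<^sub>1\<^esup> \<and> \<dots> \<and> dt\<^bsup>i\<^sub>s\<^esup>\<close>, with the determinant normalisation.\<close>

definition dt_wedge :: "'m list \<Rightarrow> 'm::finite rvec list \<Rightarrow> real"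
  where "dt_wedge is ws = (if length ws = length is
     then \<Sum>\<pi> | \<pi> permutes {..<length is}.
            of_int (sign \<pi>) * (\<Prod>a<length is. (ws ! \<pi> a) $ (is ! a))
     else 0)"

text \<open>\<open>\<Phi> ws\<close> is the scalar form obtained by evaluating the \<open>\<Lambda>\<^sup>s \<real>\<^sup>m\<^sup>*\<close> factor on \<open>ws\<close>.\<close>

type_synonym ('m, 'n) vform = "'m rvec list \<Rightarrow> ('m, 'n) form"

text \<open>The completely skew components: \<open>\<Phi> = \<phi>\<^bsub>i\<^sub>1\<dots>i\<^sub>s\<^esub> \<otimes> dt\<^bsup>i\<^sub>1\<^esup> \<and> \<dots> \<and> dt\<^bsup>i\<^sub>s\<^esup>\<close> is summed over
  all index lists, whence the factor \<open>1/s!\<close>.\<close>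

definition vcomp :: "nat \<Rightarrow> ('m, 'n) vform \<Rightarrow> 'm::finite list \<Rightarrow> ('m, 'n::finite) form"
  where "vcomp s \<Phi> is = (\<lambda>u vs. \<Phi> (map (\<lambda>i. axis i 1) is) u vs / fact s)"

definition v_d :: "nat \<Rightarrow> nat \<Rightarrow> ('m::finite, 'n::finite) vform \<Rightarrow> ('m, 'n) vform"
  where "v_d k s \<Phi> = (\<lambda>ws u vs. \<Sum>is | length is = s.
     ext_d k (vcomp s \<Phi> is) u vs * dt_wedge is ws)"

definition v_i_T :: "nat \<Rightarrow> nat \<Rightarrow> ('m::finite, 'n::finite) vform \<Rightarrow> ('m, 'n) vform"
  where "v_i_T k s \<Phi> = (\<lambda>ws u vs. \<Sum>is | length is = s. \<Sum>j\<in>UNIV.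
     i_total k j (vcomp s \<Phi> is) u vs * dt_wedge (j # is) ws)"

text \<open>\<open>P\<^sup>j\<^bsub>(s)\<^esub>\<close> on scalar \<open>r\<close>-forms of order \<open>k\<close>\<close>

definition P_scalar ::
    "nat \<Rightarrow> nat \<Rightarrow> nat \<Rightarrow> 'm \<Rightarrow> ('m::{finite,linorder}, 'n::finite) form \<Rightarrow> ('m, 'n) form"
  where "P_scalar k r s j \<phi> = (\<lambda>u vs. \<Sum>J | mlen J \<le> r * k - 1.
     ((-1) ^ mlen J * fact (CARD('m) - s) * fact (mlen J)) /
     (real r ^ (mlen J + 1) * fact (CARD('m) - s + mlen J + 1) * real (mfact J)) *
     d_multi k J (S_multi k (J + axis j 1) \<phi>) u vs)"

text \<open>Contraction of \<open>\<partial>/\<partial>t\<^sup>j\<close> with an alternating form inserts it as the first argument.\<close>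

definition v_P ::
    "nat \<Rightarrow> nat \<Rightarrow> nat \<Rightarrow> ('m::{finite,linorder}, 'n::finite) vform \<Rightarrow> ('m, 'n) vform"
  where "v_P k r s \<Phi> = (\<lambda>ws u vs. \<Sum>is | length is = s. \<Sum>j\<in>UNIV.
     P_scalar k r s j (vcomp s \<Phi> is) u vs * dt_wedge is (axis j 1 # ws))"

text \<open>A vector-valued form on a frame bundle is given by its coordinate expressions in all
  charts.\<close>

type_synonym ('e, 'm, 'n) bundle_vform = "('e, 'n) chart \<Rightarrow> ('m, 'n) vform"

text \<open>The representative \<open>L d\<^sup>mt\<close> of the class \<open>\<Theta>\<^sub>0\<close>; since \<open>d\<close> annihilates constants, \<open>d\<Theta>\<^sub>0\<close> may be
  computed from it.\<close>

definition Theta0 ::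
    "'e topology \<Rightarrow> ('e, 'n::finite) chart set \<Rightarrow> nat \<Rightarrow>
     (('m::{finite,linorder} rvec \<Rightarrow> 'e) set \<Rightarrow> real) \<Rightarrow> ('e, 'm, 'n) bundle_vform"
  where "Theta0 X A k L = (\<lambda>c ws u vs.
     form_of_fun (coord_expr X A k L c) u vs * dt_wedge (sorted_list_of_set UNIV) ws)"

definition Theta1 ::
    "'e topology \<Rightarrow> ('e, 'n::finite) chart set \<Rightarrow> nat \<Rightarrow>
     (('m::{finite,linorder} rvec \<Rightarrow> 'e) set \<Rightarrow> real) \<Rightarrow> ('e, 'm, 'n) bundle_vform"
  where "Theta1 X A k L = (\<lambda>c. v_P k 1 CARD('m) (v_d k CARD('m) (Theta0 X A k L c)))"

text \<open>Equality of vector-valued functions modulo constants. The constant \<open>C\<close>, an element of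
  \<open>\<Lambda>\<^sup>s \<real>\<^sup>m\<^sup>*\<close> evaluated on \<open>ws\<close>, is the same for all charts.\<close>

definition eq_mod_const ::
    "('e, 'n) chart set \<Rightarrow> ('e, 'm::finite, 'n::finite) bundle_vform \<Rightarrow>
     ('e, 'm, 'n) bundle_vform \<Rightarrow> bool"
  where "eq_mod_const A \<Phi> \<Psi> \<longleftrightarrow>
    (\<exists>C. \<forall>c\<in>A. \<forall>u\<in>coord_dom c. \<forall>ws. \<Phi> c ws u [] = \<Psi> c ws u [] + C ws)"

end

theory Submission
  imports Defs
begin

text \<open>The equality holds on the nose, with constant \<open>0\<close>, and it can be checked in one chart. On a
  chart let \<open>g\<close> be the coordinate expression of \<open>L\<close>. Expanding \<open>P\<close> for \<open>r = 1\<close> and \<open>s = m\<close>,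
  contraction of \<open>P\<^sup>j dg\<close> with \<open>T\<^sub>i\<close> is a sum over \<open>J\<close> of multiples of
  \<open>i\<^sub>i d\<^sub>J S\<^bsup>J+1\<^sub>j\<^esup> dg\<close>. On 1-forms \<open>i\<^sub>i\<close> commutes with \<open>d\<^sub>j\<close>, because \<open>T\<^sub>i\<close> and \<open>T\<^sub>j\<close>
  commute (\<open>i_total_d_total\<close>), and \<open>i\<^sub>i S\<^sup>K dg = dg(S\<^sup>K T\<^sub>i)\<close> is the derivative of \<open>g\<close> along
  \<open>\<Delta>\<^sup>K\<^sub>i\<close>. The term is therefore \<open>d\<^sub>J\<close> of a function which homogeneity makes zero when
  \<open>J \<noteq> 0\<close>; the term \<open>J = 0\<close> is \<open>\<delta>\<^sub>i\<^sub>j g\<close> (\<open>P_scalar_homogeneous\<close>).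

  Hence contracting \<open>\<Theta>\<^sub>1\<close> with \<open>T\<^sub>i\<close> gives \<open>g\<close> times the contraction of \<open>\<partial>/\<partial>t\<^sup>i\<close> with
  \<open>d\<^sup>mt\<close>, and the sum over \<open>i\<close> of \<open>dt\<^sup>i\<close> wedged with the latter is \<open>m d\<^sup>mt\<close>. As vector-valued
  forms are expanded here over all index lists, this step and the passage to skew components all
  rest on one identity for sums of products of \<open>dt_wedge\<close> (\<open>sum_dt_wedge_axes\<close>).

  The calculus takes place on functions of infinitely many coordinates, differentiated along
  coordinate lines only. So that all operators stay within it, a 1-form is described by its
  coefficients, which are smooth and depend on the coordinates up to a fixed order; each \<open>d\<^sub>j\<close>
  raises that order by one and each \<open>S\<^sup>i\<close> keeps it.\<close>


section \<open>Multi-indices\<close>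

text \<open>Rewriting \<open>1\<close> to \<open>Suc 0\<close> inside \<open>axis i 1\<close> would block the rules for multi-indices.\<close>

declare One_nat_def [simp del]

lemma mlen_add_axis: "mlen (I + axis i 1) = Suc (mlen I)"
  by (simp add: mlen_def sum.distrib axis_def)

lemma mlen_zero: "mlen 0 = 0"
  by (simp add: mlen_def)

lemma mlen_eq_0_iff: "mlen I = 0 \<longleftrightarrow> I = 0"
  by (simp add: mlen_def vec_eq_iff)

lemma length_mword: "length (mword I) = mlen I"
proof -
  have "length (mword I) = sum_list (map (\<lambda>i. I $ i) (sorted_list_of_set UNIV))"
    by (simp add: mword_def length_concat o_def)
  also have "\<dots> = mlen I"
    by (simp add: sum_list_distinct_conv_sum_set mlen_def)
  finally show ?thesis .
qed

lemma finite_mlen_le: "finite {I :: 'm::finite mindex. mlen I \<le> k}"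
proof (rule finite_subset)
  show "{I :: 'm mindex. mlen I \<le> k} \<subseteq> vec_lambda ` (\<Pi>\<^sub>E i\<in>UNIV. {..k})"
  proof
    fix I :: "'m mindex"
    assume "I \<in> {I. mlen I \<le> k}"
    then have "I $ i \<le> k" for i
      using member_le_sum[of i UNIV "\<lambda>i. I $ i"] by (simp add: mlen_def)
    then have "(\<lambda>i. I $ i) \<in> (\<Pi>\<^sub>E i\<in>UNIV. {..k})"
      by auto
    then show "I \<in> vec_lambda ` (\<Pi>\<^sub>E i\<in>UNIV. {..k})"
      by (rule image_eqI[rotated]) simp
  qed
  show "finite (vec_lambda ` (\<Pi>\<^sub>E i\<in>(UNIV::'m set). {..k}))"
    by (intro finite_imageI finite_PiE) auto
qed

lemma minus_axis_add: "0 < (I :: 'm::finite mindex) $ i \<Longrightarrow> I - axis i 1 + axis i 1 = I"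
  by (simp add: vec_eq_iff axis_def)

lemma add_axis_minus: "(I :: 'm::finite mindex) + axis i 1 - axis i 1 = I"
  by (simp add: vec_eq_iff)

text \<open>The reindexing behind the operators \<open>d\<^sub>j\<close> and \<open>S\<^sup>i\<close>, which shift multi-indices by \<open>1\<^sub>i\<close>.\<close>

lemma sum_shift_mindex:
  fixes h :: "'m::finite mindex \<Rightarrow> real"
  shows "(\<Sum>I | mlen I \<le> k. h (I + axis i 1)) =
    (\<Sum>I | mlen I \<le> Suc k. if 0 < I $ i then h I else 0)"
proof -
  have "(\<Sum>I | mlen I \<le> k. h (I + axis i 1)) = (\<Sum>I | mlen I \<le> Suc k \<and> 0 < I $ i. h I)"
  proof (rule sum.reindex_bij_witness[of _ "\<lambda>I. I - axis i 1" "\<lambda>I. I + axis i 1"])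
    fix I :: "'m mindex"
    assume I: "I \<in> {I. mlen I \<le> Suc k \<and> 0 < I $ i}"
    then show "I - axis i 1 + axis i 1 = I"
      by (simp add: minus_axis_add)
    with I show "I - axis i 1 \<in> {I. mlen I \<le> k}"
      using mlen_add_axis[of "I - axis i 1" i] by simp
  qed (auto simp: mlen_add_axis add_axis_minus)
  also have "\<dots> = (\<Sum>I | mlen I \<le> Suc k. if 0 < I $ i then h I else 0)"
    by (rule sum.mono_neutral_cong_left) (auto simp: finite_mlen_le)
  finally show ?thesis .
qed


section \<open>Functions of the jet coordinates\<close>

text \<open>Partial derivatives only see the values on coordinate lines, so openness is required along
  these lines only.\<close>

definition line_open :: "('m::finite, 'n::finite) coords set \<Rightarrow> bool"
  where "line_open D \<longleftrightarrow> (\<forall>u\<in>D. \<forall>I \<alpha>. \<forall>\<^sub>F x in nhds 0. coord_line I \<alpha> u x \<in> D)"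

lemma coord_line_0: "coord_line I \<alpha> u 0 = u"
  by (simp add: coord_line_def)

lemma line_open_coord_dom:
  fixes c :: "('e, 'n::finite) chart"
  assumes "open (snd c ` fst c)"
  shows "line_open (coord_dom c :: ('m::finite, 'n) coords set)"
  unfolding line_open_def
proof (intro ballI allI)
  fix u :: "('m, 'n) coords" and I and \<alpha> :: 'n
  assume u: "u \<in> coord_dom c"
  define f where "f w = (\<lambda>a::'m rvec. \<Sum>i\<in>UNIV. a $ i *\<^sub>R w (axis i 1))" for w :: "('m, 'n) coords"
  have lin: "linear (f w)" for w
    unfolding f_def
    by (rule linearI) (simp_all add: sum.distrib scaleR_add_left scaleR_sum_right)
  from u have inj: "inj (f u)" and u0: "u 0 \<in> snd c ` fst c"
    by (auto simp: coord_dom_def f_def)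
  obtain B where B: "B > 0" "\<And>a. B * norm a \<le> norm (f u a)"
    using linear_inj_bounded_below_pos[OF lin inj] by metis
  have "((\<lambda>x. coord_line I \<alpha> u x 0) \<longlongrightarrow> coord_line I \<alpha> u 0 0) (nhds 0)"
    unfolding coord_line_def fun_upd_def
    by (cases "0 = I") (auto intro!: tendsto_eq_intros filterlim_ident)
  then have ev0: "\<forall>\<^sub>F x in nhds 0. coord_line I \<alpha> u x 0 \<in> snd c ` fst c"
    using assms u0 by (auto simp: coord_line_0 dest: topological_tendstoD)
  have ev1: "\<forall>\<^sub>F x in nhds (0::real). \<bar>x\<bar> * real CARD('m) < B"
  proof -
    have "((\<lambda>x. \<bar>x\<bar> * real CARD('m)) \<longlongrightarrow> \<bar>0\<bar> * real CARD('m)) (nhds (0::real))"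
      by (intro tendsto_intros filterlim_ident)
    then show ?thesis
      using B(1) by (auto dest: order_tendstoD(2))
  qed
  \<comment> \<open>The move along the line changes the map by a perturbation of norm at most \<open>m \<bar>x\<bar>\<close>, less than
    the lower bound \<open>B\<close> on the stretching of unit vectors.\<close>
  have inj_near: "inj (f (coord_line I \<alpha> u x))" if x: "\<bar>x\<bar> * real CARD('m) < B" for x
  proof (subst linear_injective_0[OF lin], intro allI impI, rule ccontr)
    fix a assume a: "f (coord_line I \<alpha> u x) a = 0" "a \<noteq> 0"
    have "f (coord_line I \<alpha> u x) a - f u a =
        (\<Sum>i\<in>UNIV. a $ i *\<^sub>R (if axis i 1 = I then x *\<^sub>R axis \<alpha> 1 else 0))"
      unfolding f_def sum_subtractf[symmetric] scaleR_diff_right[symmetric]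
      by (intro sum.cong refl) (auto simp: coord_line_def)
    also have "norm \<dots> \<le> (\<Sum>i\<in>(UNIV :: 'm set). norm a * \<bar>x\<bar>)"
      by (intro order.trans[OF norm_sum] sum_mono)
        (auto simp: norm_axis_1 intro!: mult_right_mono component_le_norm_cart)
    finally have "norm (f u a) \<le> norm a * (\<bar>x\<bar> * real CARD('m))"
      using a by (simp add: mult_ac)
    also have "\<dots> < norm a * B"
      using a x by simp
    finally show False
      using B(2)[of a] by (simp add: mult_ac)
  qed
  from ev0 ev1 show "\<forall>\<^sub>F x in nhds 0. coord_line I \<alpha> u x \<in> coord_dom c"
    by eventually_elim (use inj_near in \<open>auto simp: coord_dom_def f_def\<close>)
qed

definition has_partials :: "(('m::finite, 'n::finite) coords \<Rightarrow> real) \<Rightarrow> ('m, 'n) coords \<Rightarrow> bool"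
  where "has_partials g u \<longleftrightarrow>
    (\<forall>I \<alpha>. ((\<lambda>x. g (coord_line I \<alpha> u x)) has_field_derivative pderiv_coord I \<alpha> g u) (at 0))"

lemma has_partialsD:
  "has_partials g u \<Longrightarrow>
    ((\<lambda>x. g (coord_line I \<alpha> u x)) has_field_derivative pderiv_coord I \<alpha> g u) (at 0)"
  by (simp add: has_partials_def)

lemma pderiv_coordI:
  "((\<lambda>x. g (coord_line I \<alpha> u x)) has_field_derivative d) (at 0) \<Longrightarrow> pderiv_coord I \<alpha> g u = d"
  by (simp add: pderiv_coord_def DERIV_imp_deriv)

lemma has_partialsI:
  assumes "\<And>I \<alpha>. ((\<lambda>x. g (coord_line I \<alpha> u x)) has_field_derivative d I \<alpha>) (at 0)"
  shows "has_partials g u"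
  using assms pderiv_coordI[OF assms] by (simp add: has_partials_def)

lemma has_partials_iff:
  "has_partials g u \<longleftrightarrow> (\<forall>I \<alpha>. (\<lambda>x. g (coord_line I \<alpha> u x)) differentiable (at 0))"
  by (simp add: has_partials_def pderiv_coord_def DERIV_deriv_iff_real_differentiable)

lemma deriv_mult_line:
  assumes "has_partials g u" "has_partials h u"
  shows "((\<lambda>x. g (coord_line I \<alpha> u x) * h (coord_line I \<alpha> u x)) has_field_derivative
    pderiv_coord I \<alpha> g u * h u + g u * pderiv_coord I \<alpha> h u) (at 0)"
  by (rule derivative_eq_intros has_partialsD assms refl)+ (simp add: coord_line_0 mult_ac)

lemma has_partials_mult:
  "has_partials g u \<Longrightarrow> has_partials h u \<Longrightarrow> has_partials (\<lambda>w. g w * h w) u"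
  by (rule has_partialsI, rule deriv_mult_line)

lemma pderiv_coord_mult:
  "has_partials g u \<Longrightarrow> has_partials h u \<Longrightarrow> pderiv_coord I \<alpha> (\<lambda>w. g w * h w) u =
    pderiv_coord I \<alpha> g u * h u + g u * pderiv_coord I \<alpha> h u"
  by (rule pderiv_coordI, rule deriv_mult_line)

lemma deriv_sum_line:
  assumes "\<And>x. x \<in> F \<Longrightarrow> has_partials (g x) u"
  shows "((\<lambda>t. \<Sum>x\<in>F. g x (coord_line I \<alpha> u t)) has_field_derivative
    (\<Sum>x\<in>F. pderiv_coord I \<alpha> (g x) u)) (at 0)"
  by (intro DERIV_sum has_partialsD assms)

lemma has_partials_sum:
  "(\<And>x. x \<in> F \<Longrightarrow> has_partials (g x) u) \<Longrightarrow> has_partials (\<lambda>w. \<Sum>x\<in>F. g x w) u"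
  by (rule has_partialsI, rule deriv_sum_line)

lemma pderiv_coord_sum:
  "(\<And>x. x \<in> F \<Longrightarrow> has_partials (g x) u) \<Longrightarrow>
    pderiv_coord I \<alpha> (\<lambda>w. \<Sum>x\<in>F. g x w) u = (\<Sum>x\<in>F. pderiv_coord I \<alpha> (g x) u)"
  by (rule pderiv_coordI, rule deriv_sum_line)

lemma deriv_coordinate_line:
  "((\<lambda>x. coord_line I \<alpha> u x J $ \<beta>) has_field_derivative (if I = J \<and> \<alpha> = \<beta> then 1 else 0)) (at 0)"
proof -
  have "coord_line I \<alpha> u x J $ \<beta> = u J $ \<beta> + (if I = J \<and> \<alpha> = \<beta> then 1 else 0) * x" for x
    by (auto simp: coord_line_def axis_def)
  then show ?thesis
    by (auto intro!: derivative_eq_intros)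
qed

lemma has_partials_coordinate: "has_partials (\<lambda>w. w J $ \<beta>) u"
  by (rule has_partialsI, rule deriv_coordinate_line)

lemma pderiv_coordinate:
  "pderiv_coord I \<alpha> (\<lambda>w. w J $ \<beta>) u = (if I = J \<and> \<alpha> = \<beta> then 1 else 0)"
  by (rule pderiv_coordI, rule deriv_coordinate_line)

lemma has_partials_const: "has_partials (\<lambda>w. c) u"
  by (rule has_partialsI[of _ _ "\<lambda>_ _. 0"]) simp

lemma pderiv_coord_const: "pderiv_coord I \<alpha> (\<lambda>w. c) u = 0"
  by (rule pderiv_coordI) simp

lemma pderiv_coord_cong:
  assumes "line_open D" "u \<in> D" "\<And>w. w \<in> D \<Longrightarrow> g w = h w"
  shows "pderiv_coord I \<alpha> g u = pderiv_coord I \<alpha> h u"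
  unfolding pderiv_coord_def
proof (rule deriv_cong_ev)
  have "\<forall>\<^sub>F x in nhds 0. coord_line I \<alpha> u x \<in> D"
    using assms by (simp add: line_open_def)
  then show "\<forall>\<^sub>F x in nhds 0. g (coord_line I \<alpha> u x) = h (coord_line I \<alpha> u x)"
    by eventually_elim (rule assms)
qed simp

lemma has_partials_cong:
  assumes D: "line_open D" "u \<in> D" "\<And>w. w \<in> D \<Longrightarrow> g w = h w" and g: "has_partials g u"
  shows "has_partials h u"
proof (rule has_partialsI)
  fix I \<alpha>
  have "\<forall>\<^sub>F x in nhds 0. coord_line I \<alpha> u x \<in> D"
    using D by (simp add: line_open_def)
  then have "\<forall>\<^sub>F x in nhds 0. g (coord_line I \<alpha> u x) = h (coord_line I \<alpha> u x)"
    by eventually_elim (rule D)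
  then show "((\<lambda>x. h (coord_line I \<alpha> u x)) has_field_derivative pderiv_coord I \<alpha> g u) (at 0)"
    using has_partialsD[OF g] by (rule DERIV_cong_ev[THEN iffD1, OF refl _ refl])
qed

lemma Ck_coords_Suc_iff:
  "Ck_coords D g (Suc p) \<longleftrightarrow> continuous_on D g \<and> (\<forall>u\<in>D. has_partials g u) \<and>
    (\<forall>I \<alpha>. Ck_coords D (pderiv_coord I \<alpha> g) p)"
  by (auto simp: has_partials_iff)

text \<open>From here on \<open>has_partials\<close> takes the place of differentiability along the lines.\<close>

declare Ck_coords.simps(2) [simp del]

lemma Ck_coords_continuous: "Ck_coords D g p \<Longrightarrow> continuous_on D g"
  by (cases p) (auto simp: Ck_coords_Suc_iff)

text \<open>Smoothness is only a matter of the values on \<open>D\<close>. This allows the derivation rules, which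
  hold at the points of \<open>D\<close>, to be used under further derivatives.\<close>

lemma Ck_coords_cong:
  assumes "line_open D"
  shows "(\<And>u. u \<in> D \<Longrightarrow> g u = h u) \<Longrightarrow> Ck_coords D g p \<Longrightarrow> Ck_coords D h p"
proof (induction p arbitrary: g h)
  case 0
  then show ?case
    by (auto intro: continuous_on_eq)
next
  case (Suc p)
  have g: "continuous_on D g" "\<And>u. u \<in> D \<Longrightarrow> has_partials g u"
      "\<And>I \<alpha>. Ck_coords D (pderiv_coord I \<alpha> g) p"
    using Suc.prems(2) by (simp_all add: Ck_coords_Suc_iff)
  have "continuous_on D h"
    using g(1) Suc.prems(1) by (rule continuous_on_eq)
  moreover have "has_partials h u" if "u \<in> D" for u
    using has_partials_cong[OF assms that Suc.prems(1)] g(2) that by simp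
  moreover have "Ck_coords D (pderiv_coord I \<alpha> h) p" for I \<alpha>
    using pderiv_coord_cong[OF assms _ Suc.prems(1)] g(3)
    by (rule Suc.IH)
  ultimately show ?case
    by (simp add: Ck_coords_Suc_iff)
qed

lemma Ck_coords_SucD: "Ck_coords D g (Suc p) \<Longrightarrow> Ck_coords D g p"
proof (induction p arbitrary: g)
  case (Suc p)
  from Suc.prems show ?case
    unfolding Ck_coords_Suc_iff[of D g "Suc p"] Ck_coords_Suc_iff[of D g p] by (blast intro: Suc.IH)
qed (simp add: Ck_coords_Suc_iff)

lemma Ck_coords_const: "Ck_coords D (\<lambda>u. c) p"
proof (induction p arbitrary: c)
  case (Suc p)
  have "pderiv_coord I \<alpha> (\<lambda>u :: ('a, 'b) coords. c) = (\<lambda>u. 0)" for I \<alpha>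
    by (simp add: fun_eq_iff pderiv_coord_const)
  then show ?case
    using Suc by (simp add: Ck_coords_Suc_iff has_partials_const)
qed simp

lemma continuous_on_coordinate: "continuous_on D (\<lambda>u. u J $ \<beta>)"
  by (intro continuous_intros continuous_on_subset[OF continuous_on_product_coordinates]) auto

lemma Ck_coords_coordinate: "Ck_coords D (\<lambda>u. u J $ \<beta>) p"
proof (cases p)
  case 0
  then show ?thesis by (simp add: continuous_on_coordinate)
next
  case (Suc q)
  have "pderiv_coord I \<alpha> (\<lambda>u :: ('a, 'b) coords. u J $ \<beta>) = (\<lambda>u. if I = J \<and> \<alpha> = \<beta> then 1 else 0)" for I \<alpha>
    by (rule ext, rule pderiv_coordinate)
  then show ?thesis
    using Suc by (simp add: Ck_coords_Suc_iff has_partials_coordinate Ck_coords_const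
        continuous_on_coordinate)
qed

lemma Ck_coords_sum:
  assumes "line_open D"
  shows "(\<And>x. x \<in> F \<Longrightarrow> Ck_coords D (g x) p) \<Longrightarrow> Ck_coords D (\<lambda>u. \<Sum>x\<in>F. g x u) p"
proof (induction p arbitrary: g)
  case 0
  then show ?case by (auto intro!: continuous_on_sum)
next
  case (Suc p)
  have hp: "has_partials (g x) u" if "x \<in> F" "u \<in> D" for x u
    using Suc.prems that by (simp add: Ck_coords_Suc_iff)
  have "Ck_coords D (pderiv_coord I \<alpha> (\<lambda>u. \<Sum>x\<in>F. g x u)) p" for I \<alpha>
  proof (rule Ck_coords_cong[OF assms])
    show "Ck_coords D (\<lambda>u. \<Sum>x\<in>F. pderiv_coord I \<alpha> (g x) u) p"
      using Suc by (simp add: Ck_coords_Suc_iff)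
  qed (simp add: pderiv_coord_sum hp)
  moreover have "continuous_on D (\<lambda>u. \<Sum>x\<in>F. g x u)"
    using Suc.prems by (intro continuous_on_sum) (auto intro: Ck_coords_continuous)
  ultimately show ?case
    by (simp add: Ck_coords_Suc_iff has_partials_sum hp)
qed

lemma Ck_coords_add:
  assumes "line_open D" "Ck_coords D g p" "Ck_coords D h p"
  shows "Ck_coords D (\<lambda>u. g u + h u) p"
  using Ck_coords_sum[OF assms(1), of "UNIV :: bool set" "\<lambda>b. if b then g else h" p] assms(2,3)
  by (simp add: UNIV_bool add.commute)

lemma Ck_coords_mult:
  assumes "line_open D"
  shows "Ck_coords D g p \<Longrightarrow> Ck_coords D h p \<Longrightarrow> Ck_coords D (\<lambda>u. g u * h u) p"
proof (induction p arbitrary: g h)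
  case 0
  then show ?case by (auto intro!: continuous_on_mult)
next
  case (Suc p)
  have hp: "has_partials g u" "has_partials h u" if "u \<in> D" for u
    using Suc.prems that by (simp_all add: Ck_coords_Suc_iff)
  have "Ck_coords D (pderiv_coord I \<alpha> (\<lambda>u. g u * h u)) p" for I \<alpha>
  proof (rule Ck_coords_cong[OF assms])
    show "Ck_coords D (\<lambda>u. pderiv_coord I \<alpha> g u * h u + g u * pderiv_coord I \<alpha> h u) p"
      using Suc.prems Suc.prems[THEN Ck_coords_SucD]
      by (intro Ck_coords_add[OF assms] Suc.IH) (auto simp only: Ck_coords_Suc_iff)
  qed (simp add: pderiv_coord_mult hp)
  moreover have "continuous_on D (\<lambda>u. g u * h u)"
    using Suc.prems by (intro continuous_on_mult) (auto intro: Ck_coords_continuous)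
  ultimately show ?case
    by (simp add: Ck_coords_Suc_iff has_partials_mult hp)
qed

definition of_order :: "nat \<Rightarrow> (('m::finite, 'n::finite) coords \<Rightarrow> real) \<Rightarrow> bool"
  where "of_order k g \<longleftrightarrow> (\<forall>u w. (\<forall>I. mlen I \<le> k \<longrightarrow> u I = w I) \<longrightarrow> g u = g w)"

lemma of_order_pderiv_coord:
  fixes g :: "('m::finite, 'n::finite) coords \<Rightarrow> real"
  shows "of_order k g \<Longrightarrow> of_order k (pderiv_coord I \<alpha> g)"
  unfolding of_order_def pderiv_coord_def
proof (intro allI impI)
  fix u w :: "('m, 'n) coords"
  assume g: "\<forall>u w. (\<forall>I. mlen I \<le> k \<longrightarrow> u I = w I) \<longrightarrow> g u = g w"
    and uw: "\<forall>I. mlen I \<le> k \<longrightarrow> u I = w I"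
  have "g (coord_line I \<alpha> u x) = g (coord_line I \<alpha> w x)" for x
    using uw by (intro g[rule_format]) (auto simp: coord_line_def)
  then show "deriv (\<lambda>x. g (coord_line I \<alpha> u x)) 0 = deriv (\<lambda>x. g (coord_line I \<alpha> w x)) 0"
    by simp
qed

lemma of_order_pderiv_coord_eq_0:
  assumes "of_order k g" "k < mlen I"
  shows "pderiv_coord I \<alpha> g u = 0"
proof (rule pderiv_coordI)
  have "g (coord_line I \<alpha> u x) = g u" for x
    using assms(2)
    by (intro assms(1)[unfolded of_order_def, rule_format]) (auto simp: coord_line_def)
  then show "((\<lambda>x. g (coord_line I \<alpha> u x)) has_field_derivative 0) (at 0)"
    by simp
qed

lemma of_order_coord_expr:
  fixes L :: "('m::{finite,linorder} rvec \<Rightarrow> 'e) set \<Rightarrow> real" and c :: "('e, 'n::finite) chart"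
  shows "of_order k (coord_expr X A k L c)"
  unfolding of_order_def coord_expr_def
proof (intro allI impI arg_cong[where f = L])
  fix u w :: "('m, 'n) coords"
  assume "\<forall>I. mlen I \<le> k \<longrightarrow> u I = w I"
  then have "(\<forall>I. mlen I \<le> k \<longrightarrow> f I = u I) \<longleftrightarrow> (\<forall>I. mlen I \<le> k \<longrightarrow> f I = w I)" for f
    by auto
  then show "frame_at X A k c u = frame_at X A k c w"
    by (simp add: frame_at_def)
qed


section \<open>Differentiation along vector fields\<close>

lemma vec_apply_cong:
  assumes "line_open D" "u \<in> D" "\<And>w. w \<in> D \<Longrightarrow> g w = h w"
  shows "vec_apply k v g u = vec_apply k v h u"
  unfolding vec_apply_def by (simp add: pderiv_coord_cong[OF assms])

lemma vec_apply_const: "vec_apply k v (\<lambda>w. c) u = 0"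
  by (simp add: vec_apply_def pderiv_coord_const)

lemma vec_apply_sum:
  assumes "\<And>x. x \<in> F \<Longrightarrow> has_partials (g x) u"
  shows "vec_apply k v (\<lambda>w. \<Sum>x\<in>F. g x w) u = (\<Sum>x\<in>F. vec_apply k v (g x) u)"
proof -
  have "vec_apply k v (\<lambda>w. \<Sum>x\<in>F. g x w) u =
      (\<Sum>I | mlen I \<le> k. \<Sum>\<alpha>\<in>UNIV. \<Sum>x\<in>F. v I $ \<alpha> * pderiv_coord I \<alpha> (g x) u)"
    unfolding vec_apply_def by (simp add: pderiv_coord_sum assms sum_distrib_left)
  also have "\<dots> = (\<Sum>x\<in>F. \<Sum>I | mlen I \<le> k. \<Sum>\<alpha>\<in>UNIV. v I $ \<alpha> * pderiv_coord I \<alpha> (g x) u)"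
    by (subst (2) sum.swap, subst sum.swap) simp
  finally show ?thesis
    by (simp add: vec_apply_def)
qed

lemma vec_apply_mult:
  assumes "has_partials g u" "has_partials h u"
  shows "vec_apply k v (\<lambda>w. g w * h w) u = vec_apply k v g u * h u + g u * vec_apply k v h u"
  unfolding vec_apply_def pderiv_coord_mult[OF assms]
  by (simp add: sum_distrib_left sum_distrib_right sum.distrib[symmetric] algebra_simps)

lemma vec_apply_coordinate:
  "vec_apply k v (\<lambda>w. w J $ \<beta>) u = (if mlen J \<le> k then v J $ \<beta> else 0)"
proof -
  have "v I $ \<alpha> * pderiv_coord I \<alpha> (\<lambda>w. w J $ \<beta>) u =
      (if \<alpha> = \<beta> then if I = J then v J $ \<beta> else 0 else 0)" for I \<alpha>
    by (simp add: pderiv_coordinate)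
  then show ?thesis
    unfolding vec_apply_def by (simp add: finite_mlen_le)
qed

lemma vec_apply_of_order:
  assumes "of_order k g" "k \<le> k'" "\<And>I. mlen I \<le> k \<Longrightarrow> v I = v' I"
  shows "vec_apply k' v g u = vec_apply k v' g u"
  unfolding vec_apply_def
  by (rule sum.mono_neutral_cong_right)
    (use assms in \<open>auto simp: finite_mlen_le of_order_pderiv_coord_eq_0\<close>)

text \<open>If \<open>a\<close> are the coefficients of a 1-form \<open>\<phi>\<close> of order \<open>k\<close>, the function differentiated
  here is \<open>i\<^sub>j\<phi>\<close>. It is of order \<open>k + 1\<close>, so that no component of \<open>v\<close> that matters is cut off.\<close>

lemma vec_apply_contraction:
  assumes "\<And>I \<alpha>. has_partials (a I \<alpha>) u"
  shows "vec_apply (Suc k) v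
      (\<lambda>w. \<Sum>I | mlen I \<le> k. \<Sum>\<alpha>\<in>UNIV. w (I + axis j 1) $ \<alpha> * a I \<alpha> w) u =
    (\<Sum>I | mlen I \<le> k. \<Sum>\<alpha>\<in>UNIV. v (I + axis j 1) $ \<alpha> * a I \<alpha> u +
      u (I + axis j 1) $ \<alpha> * vec_apply (Suc k) v (a I \<alpha>) u)"
proof -
  have "vec_apply (Suc k) v
      (\<lambda>w. \<Sum>I | mlen I \<le> k. \<Sum>\<alpha>\<in>UNIV. w (I + axis j 1) $ \<alpha> * a I \<alpha> w) u =
    (\<Sum>I | mlen I \<le> k. \<Sum>\<alpha>\<in>UNIV.
      vec_apply (Suc k) v (\<lambda>w. w (I + axis j 1) $ \<alpha> * a I \<alpha> w) u)"
    by (simp add: vec_apply_sum has_partials_sum has_partials_mult has_partials_coordinate assms)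
  also have "\<dots> = (\<Sum>I | mlen I \<le> k. \<Sum>\<alpha>\<in>UNIV. v (I + axis j 1) $ \<alpha> * a I \<alpha> u +
      u (I + axis j 1) $ \<alpha> * vec_apply (Suc k) v (a I \<alpha>) u)"
    by (intro sum.cong refl)
      (simp add: vec_apply_mult has_partials_coordinate assms vec_apply_coordinate mlen_add_axis)
  finally show ?thesis .
qed


section \<open>Smooth 1-forms and total derivatives\<close>

text \<open>Only the values on single vectors are constrained: the operators on 1-forms and the
  contraction with \<open>T\<^sub>j\<close> never evaluate a 1-form on a list of another length.\<close>

definition coeffs_1form ::
    "('m::finite, 'n::finite) coords set \<Rightarrow> nat \<Rightarrow> ('m mindex \<Rightarrow> 'n \<Rightarrow> ('m, 'n) coords \<Rightarrow> real) \<Rightarrow>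
     ('m, 'n) form \<Rightarrow> bool"
  where "coeffs_1form D k a \<phi> \<longleftrightarrow>
    (\<forall>I \<alpha>. of_order k (a I \<alpha>) \<and> (\<forall>p. Ck_coords D (a I \<alpha>) p)) \<and>
    (\<forall>u\<in>D. \<forall>v. \<phi> u [v] = (\<Sum>I | mlen I \<le> k. \<Sum>\<alpha>\<in>UNIV. v I $ \<alpha> * a I \<alpha> u))"

definition smooth_1form ::
    "('m::finite, 'n::finite) coords set \<Rightarrow> nat \<Rightarrow> ('m, 'n) form \<Rightarrow> bool"
  where "smooth_1form D k \<phi> \<longleftrightarrow> (\<exists>a. coeffs_1form D k a \<phi>)"

lemma coeffs_1form_eq:
  "coeffs_1form D k a \<phi> \<Longrightarrow> u \<in> D \<Longrightarrow>
    \<phi> u [v] = (\<Sum>I | mlen I \<le> k. \<Sum>\<alpha>\<in>UNIV. v I $ \<alpha> * a I \<alpha> u)"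
  by (simp add: coeffs_1form_def)

lemma coeffs_1form_has_partials: "coeffs_1form D k a \<phi> \<Longrightarrow> u \<in> D \<Longrightarrow> has_partials (a I \<alpha>) u"
  unfolding coeffs_1form_def by (metis Ck_coords_Suc_iff)

lemma coeffs_1form_order: "coeffs_1form D k a \<phi> \<Longrightarrow> of_order k (a I \<alpha>)"
  by (simp add: coeffs_1form_def)

lemma smooth_1form_apply_cong:
  assumes "smooth_1form D k \<phi>" "u \<in> D" "\<And>I. mlen I \<le> k \<Longrightarrow> v I = v' I"
  shows "\<phi> u [v] = \<phi> u [v']"
  using assms by (auto simp: smooth_1form_def coeffs_1form_def)

lemma contract_total_coeffs:
  assumes "coeffs_1form D k a \<phi>" "w \<in> D"
  shows "i_total k j \<phi> w [] = (\<Sum>I | mlen I \<le> k. \<Sum>\<alpha>\<in>UNIV. w (I + axis j 1) $ \<alpha> * a I \<alpha> w)"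
  by (simp add: i_total_def contract_def coeffs_1form_eq[OF assms] total_vec_def)

text \<open>The terms in which \<open>d\<phi>\<close> and \<open>d i\<^sub>j\<phi>\<close> differentiate the coefficients in the direction \<open>v\<close>
  cancel.\<close>

lemma d_total_apply:
  assumes D: "line_open D" and \<phi>: "coeffs_1form D k a \<phi>" and u: "u \<in> D"
  shows "d_total k j \<phi> u [v] = (\<Sum>I | mlen I \<le> k. \<Sum>\<alpha>\<in>UNIV.
    v I $ \<alpha> * vec_apply k (total_vec k j u) (a I \<alpha>) u + v (I + axis j 1) $ \<alpha> * a I \<alpha> u)"
proof -
  note hp = coeffs_1form_has_partials[OF \<phi> u]
  define T where "T = total_vec k j u"
  have fixed: "vec_apply k y (\<lambda>w. \<phi> w [x]) u =
      (\<Sum>I | mlen I \<le> k. \<Sum>\<alpha>\<in>UNIV. x I $ \<alpha> * vec_apply k y (a I \<alpha>) u)" for x y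
    by (subst vec_apply_cong[OF D u coeffs_1form_eq[OF \<phi>]], assumption)
      (simp add: vec_apply_sum has_partials_sum has_partials_mult has_partials_const hp
        vec_apply_mult vec_apply_const)
  have "i_total k j (ext_d k \<phi>) u [v] =
      vec_apply k T (\<lambda>w. \<phi> w [v]) u - vec_apply k v (\<lambda>w. \<phi> w [T]) u"
    by (simp add: i_total_def contract_def ext_d_def T_def lessThan_Suc numeral_2_eq_2)
  also have "\<dots> = (\<Sum>I | mlen I \<le> k. \<Sum>\<alpha>\<in>UNIV. v I $ \<alpha> * vec_apply k T (a I \<alpha>) u) -
      (\<Sum>I | mlen I \<le> k. \<Sum>\<alpha>\<in>UNIV. u (I + axis j 1) $ \<alpha> * vec_apply k v (a I \<alpha>) u)"
    by (simp add: fixed) (simp add: T_def total_vec_def)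
  finally have 1: "i_total k j (ext_d k \<phi>) u [v] = \<dots>" .
  have "ext_d (Suc k) (i_total k j \<phi>) u [v] = vec_apply (Suc k) v (\<lambda>w. i_total k j \<phi> w []) u"
    by (simp add: ext_d_def)
  also have "\<dots> = vec_apply (Suc k) v
      (\<lambda>w. \<Sum>I | mlen I \<le> k. \<Sum>\<alpha>\<in>UNIV. w (I + axis j 1) $ \<alpha> * a I \<alpha> w) u"
    by (rule vec_apply_cong[OF D u contract_total_coeffs[OF \<phi>]])
  also have "\<dots> = (\<Sum>I | mlen I \<le> k. \<Sum>\<alpha>\<in>UNIV. v (I + axis j 1) $ \<alpha> * a I \<alpha> u +
      u (I + axis j 1) $ \<alpha> * vec_apply k v (a I \<alpha>) u)"
    by (simp add: vec_apply_contraction hp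
        vec_apply_of_order[OF coeffs_1form_order[OF \<phi>], of "Suc k" v v])
  finally show ?thesis
    unfolding d_total_def 1 T_def by (simp add: sum.distrib)
qed

text \<open>The new coefficients are \<open>T\<^sub>j a\<^sub>I + a\<^bsub>I-1\<^sub>j\<^esub>\<close>, where the first term is present for
  \<open>|I| \<le> k\<close> and the second for \<open>I(j) > 0\<close>.\<close>

lemma smooth_1form_d_total:
  assumes D: "line_open D" and \<phi>: "smooth_1form D k \<phi>"
  shows "smooth_1form D (Suc k) (d_total k j \<phi>)"
proof -
  obtain a where a: "coeffs_1form D k a \<phi>"
    using \<phi> by (auto simp: smooth_1form_def)
  define T where "T I \<alpha> u = (\<Sum>J | mlen J \<le> k. \<Sum>\<beta>\<in>UNIV.
      u (J + axis j 1) $ \<beta> * pderiv_coord J \<beta> (a I \<alpha>) u)" for I \<alpha> u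
  have T: "vec_apply k (total_vec k j u) (a I \<alpha>) u = T I \<alpha> u" for I \<alpha> u
    by (simp add: vec_apply_def total_vec_def T_def)
  define b where "b I \<alpha> u = (if mlen I \<le> k then T I \<alpha> u else 0) +
      (if 0 < I $ j then a (I - axis j 1) \<alpha> u else 0)" for I \<alpha> u
  have a_order: "of_order k (a I \<alpha>)" and a_smooth: "Ck_coords D (a I \<alpha>) p" for I \<alpha> p
    using a by (auto simp: coeffs_1form_def)
  have "Ck_coords D (pderiv_coord J \<beta> (a I \<alpha>)) p" for J \<beta> I \<alpha> p
    using a_smooth[of I \<alpha> "Suc p"] by (simp add: Ck_coords_Suc_iff)
  then have "Ck_coords D (T I \<alpha>) p" for I \<alpha> p
    unfolding T_def
    by (intro Ck_coords_sum[OF D] Ck_coords_mult[OF D] Ck_coords_coordinate)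
  then have b_smooth: "Ck_coords D (b I \<alpha>) p" for I \<alpha> p
    using a_smooth unfolding b_def
    by (cases "mlen I \<le> k"; cases "0 < I $ j")
      (auto simp: Ck_coords_const intro!: Ck_coords_add[OF D])
  have b_order: "of_order (Suc k) (b I \<alpha>)" for I \<alpha>
    unfolding of_order_def
  proof (intro allI impI)
    fix u w :: "('a, 'b) coords"
    assume uw: "\<forall>I. mlen I \<le> Suc k \<longrightarrow> u I = w I"
    have eq: "g u = g w" if "of_order k g" for g
      using that uw by (simp add: of_order_def)
    show "b I \<alpha> u = b I \<alpha> w"
      using uw unfolding b_def T_def
      by (simp add: eq[OF a_order] eq[OF of_order_pderiv_coord[OF a_order]] mlen_add_axis)
  qed
  have "d_total k j \<phi> u [v] = (\<Sum>I | mlen I \<le> Suc k. \<Sum>\<alpha>\<in>UNIV. v I $ \<alpha> * b I \<alpha> u)"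
    if u: "u \<in> D" for u v
  proof -
    have "d_total k j \<phi> u [v] = (\<Sum>I | mlen I \<le> k. \<Sum>\<alpha>\<in>UNIV. v I $ \<alpha> * T I \<alpha> u) +
        (\<Sum>I | mlen I \<le> k. \<Sum>\<alpha>\<in>UNIV. v (I + axis j 1) $ \<alpha> * a I \<alpha> u)"
      by (simp add: d_total_apply[OF D a u] T sum.distrib)
    also have "(\<Sum>I | mlen I \<le> k. \<Sum>\<alpha>\<in>UNIV. v I $ \<alpha> * T I \<alpha> u) =
        (\<Sum>I | mlen I \<le> Suc k. \<Sum>\<alpha>\<in>UNIV. v I $ \<alpha> * (if mlen I \<le> k then T I \<alpha> u else 0))"
      by (rule sum.mono_neutral_cong_left) (auto simp: finite_mlen_le)
    also have "(\<Sum>I | mlen I \<le> k. \<Sum>\<alpha>\<in>UNIV. v (I + axis j 1) $ \<alpha> * a I \<alpha> u) =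
        (\<Sum>I | mlen I \<le> Suc k. if 0 < I $ j
          then \<Sum>\<alpha>\<in>UNIV. v I $ \<alpha> * a (I - axis j 1) \<alpha> u else 0)"
      by (subst sum_shift_mindex[symmetric]) (simp only: add_axis_minus)
    also have "\<dots> = (\<Sum>I | mlen I \<le> Suc k. \<Sum>\<alpha>\<in>UNIV.
        v I $ \<alpha> * (if 0 < I $ j then a (I - axis j 1) \<alpha> u else 0))"
      by (intro sum.cong refl) simp
    finally show ?thesis
      by (simp add: b_def distrib_left sum.distrib)
  qed
  then show ?thesis
    unfolding smooth_1form_def coeffs_1form_def
    using b_smooth b_order by (intro exI[of _ b]) auto
qed

text \<open>This is \<open>i\<^sub>i d\<^sub>j = d\<^sub>j i\<^sub>i\<close> on 1-forms. The product rule for \<open>T\<^sub>j\<close> on \<open>u\<^bsub>I+1\<^sub>i\<^esub> a\<^sub>I\<close>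
  produces exactly the two terms of \<open>d_total_apply\<close>, as \<open>T\<^sub>j u\<^bsub>I+1\<^sub>i\<^esub> = u\<^bsub>I+1\<^sub>i+1\<^sub>j\<^esub>\<close> is symmetric in
  \<open>i\<close> and \<open>j\<close>.\<close>

lemma i_total_d_total:
  assumes D: "line_open D" and \<phi>: "smooth_1form D k \<phi>" and u: "u \<in> D"
  shows "i_total (Suc k) i (d_total k j \<phi>) u [] =
    vec_apply (Suc k) (total_vec (Suc k) j u) (\<lambda>w. i_total k i \<phi> w []) u"
proof -
  obtain a where a: "coeffs_1form D k a \<phi>"
    using \<phi> by (auto simp: smooth_1form_def)
  have "i_total (Suc k) i (d_total k j \<phi>) u [] = (\<Sum>I | mlen I \<le> k. \<Sum>\<alpha>\<in>UNIV.
      u (I + axis i 1) $ \<alpha> * vec_apply k (total_vec k j u) (a I \<alpha>) u +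
      u (I + axis j 1 + axis i 1) $ \<alpha> * a I \<alpha> u)"
    by (simp add: i_total_def contract_def d_total_apply[OF D a u])
      (simp add: total_vec_def mlen_add_axis)
  also have "\<dots> = (\<Sum>I | mlen I \<le> k. \<Sum>\<alpha>\<in>UNIV.
      total_vec (Suc k) j u (I + axis i 1) $ \<alpha> * a I \<alpha> u +
      u (I + axis i 1) $ \<alpha> * vec_apply (Suc k) (total_vec (Suc k) j u) (a I \<alpha>) u)"
  proof -
    have "vec_apply (Suc k) (total_vec (Suc k) j u) (a I \<alpha>) u =
        vec_apply k (total_vec k j u) (a I \<alpha>) u" for I \<alpha>
      by (rule vec_apply_of_order[OF coeffs_1form_order[OF a]]) (simp_all add: total_vec_def)
    then show ?thesis
      by simp (simp add: total_vec_def mlen_add_axis ac_simps)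
  qed
  also have "\<dots> = vec_apply (Suc k) (total_vec (Suc k) j u)
      (\<lambda>w. \<Sum>I | mlen I \<le> k. \<Sum>\<alpha>\<in>UNIV. w (I + axis i 1) $ \<alpha> * a I \<alpha> w) u"
    by (simp add: vec_apply_contraction coeffs_1form_has_partials[OF a u])
  also have "\<dots> = vec_apply (Suc k) (total_vec (Suc k) j u) (\<lambda>w. i_total k i \<phi> w []) u"
    by (rule vec_apply_cong[OF D u contract_total_coeffs[OF a, symmetric]])
  finally show ?thesis .
qed

text \<open>By the commutation rule, a 1-form that vanishes on \<open>T\<^sub>i\<close> keeps doing so under total
  derivatives.\<close>

lemma d_total_list_kills:
  assumes D: "line_open D" and \<phi>: "smooth_1form D k \<phi>"
    and zero: "\<And>u. u \<in> D \<Longrightarrow> i_total k i \<phi> u [] = 0"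
  shows "smooth_1form D (k + length js) (d_total_list k js \<phi>) \<and>
    (\<forall>u\<in>D. i_total (k + length js) i (d_total_list k js \<phi>) u [] = 0)"
proof (induction js)
  case Nil
  then show ?case using assms by simp
next
  case (Cons j js)
  let ?\<psi> = "d_total_list k js \<phi>"
  have "i_total (Suc (k + length js)) i (d_total (k + length js) j ?\<psi>) u [] = 0"
    if u: "u \<in> D" for u
  proof -
    have "vec_apply (Suc (k + length js)) (total_vec (Suc (k + length js)) j u)
        (\<lambda>w. i_total (k + length js) i ?\<psi> w []) u =
      vec_apply (Suc (k + length js)) (total_vec (Suc (k + length js)) j u) (\<lambda>w. 0) u"
      by (rule vec_apply_cong[OF D u]) (use Cons.IH in simp)
    then show ?thesis
      using Cons.IH u by (simp add: i_total_d_total[OF D] vec_apply_const)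
  qed
  then show ?case
    using Cons.IH by (simp add: smooth_1form_d_total[OF D])
qed


section \<open>Vertical endomorphisms\<close>

lemma S_vec_eq:
  "S_vec k i v J = (if 0 < J $ i \<and> mlen J \<le> k then real (J $ i) *\<^sub>R v (J - axis i 1) else 0)"
proof (cases "0 < J $ i \<and> mlen J \<le> k")
  case True
  then have "{I. mlen I < k \<and> I + axis i 1 = J} = {J - axis i 1}"
    using minus_axis_add[of J i] mlen_add_axis[of "J - axis i 1" i]
    by (auto simp: add_axis_minus)
  then show ?thesis
    using True minus_axis_add[of J i] by (simp add: S_vec_def axis_def)
next
  case False
  then have "{I. mlen I < k \<and> I + axis i 1 = J} = {}"
    by (auto simp: mlen_add_axis)
  then show ?thesis
    unfolding S_vec_def by (simp only: sum.empty False if_False)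
qed

lemma S_vec_commute:
  fixes v :: "('m::finite, 'n::finite) coords"
  shows "S_vec k i (S_vec k j v) = S_vec k j (S_vec k i v)"
proof
  fix J :: "'m mindex"
  have len: "mlen (J - I) \<le> k" if "mlen J \<le> k" for I
  proof -
    have "mlen (J - I) \<le> mlen J"
      unfolding mlen_def by (rule sum_mono) simp
    with that show ?thesis
      by simp
  qed
  have "J - axis i 1 - axis j 1 = J - axis j 1 - axis i 1"
    by (simp add: vec_eq_iff add.commute)
  then show "S_vec k i (S_vec k j v) J = S_vec k j (S_vec k i v) J"
    by (cases "i = j") (simp_all add: S_vec_eq len axis_def mult.commute)
qed

text \<open>On forms the contractions act on the argument in the opposite order, which does not matter
  because the \<open>S\<^sup>i\<close> commute.\<close>

lemma S_multi_apply: "S_multi k K \<phi> u [v] = \<phi> u [S_vec_multi k K v]"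
proof -
  have "foldr (S_form k) is \<phi> u [v] = \<phi> u [fold (S_vec k) is v]" for "is"
    by (induction "is" arbitrary: v) (simp_all add: S_form_def)
  moreover have "foldr (S_vec k) (mword K) v = fold (S_vec k) (mword K) v"
    by (subst foldr_fold) (simp_all add: fun_eq_iff S_vec_commute)
  ultimately show ?thesis
    by (simp add: S_multi_def S_vec_multi_def)
qed

lemma smooth_1form_S_form:
  assumes \<phi>: "smooth_1form D k \<phi>" and D: "line_open D" and k: "1 \<le> k"
  shows "smooth_1form D k (S_form k i \<phi>)"
proof -
  obtain a where a: "coeffs_1form D k a \<phi>"
    using \<phi> by (auto simp: smooth_1form_def)
  \<comment> \<open>The components of order \<open>k\<close> of the argument are shifted out of range.\<close>
  obtain k' where k': "k = Suc k'"
    using k by (cases k) auto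
  define b where "b I \<alpha> u = (if mlen I \<le> k' then real (I $ i + 1) * a (I + axis i 1) \<alpha> u else 0)"
    for I \<alpha> u
  have "Ck_coords D (b I \<alpha>) p" for I \<alpha> p
    using a unfolding b_def
    by (cases "mlen I \<le> k'")
      (auto simp: coeffs_1form_def Ck_coords_const intro!: Ck_coords_mult[OF D])
  moreover have "of_order k (b I \<alpha>)" for I \<alpha>
    using a unfolding b_def coeffs_1form_def of_order_def by metis
  moreover have "S_form k i \<phi> u [v] = (\<Sum>I | mlen I \<le> k. \<Sum>\<alpha>\<in>UNIV. v I $ \<alpha> * b I \<alpha> u)"
    if u: "u \<in> D" for u v
  proof -
    have "S_form k i \<phi> u [v] = (\<Sum>I | mlen I \<le> Suc k'. if 0 < I $ i
        then \<Sum>\<alpha>\<in>UNIV. v (I - axis i 1) $ \<alpha> * (real (I $ i) * a I \<alpha> u) else 0)"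
      by (auto simp: S_form_def coeffs_1form_eq[OF a u] S_vec_eq k' intro!: sum.cong)
    also have "\<dots> = (\<Sum>I | mlen I \<le> k'. \<Sum>\<alpha>\<in>UNIV. v I $ \<alpha> * b I \<alpha> u)"
      by (subst sum_shift_mindex[symmetric]) (simp add: add_axis_minus b_def axis_def)
    also have "\<dots> = (\<Sum>I | mlen I \<le> k. \<Sum>\<alpha>\<in>UNIV. v I $ \<alpha> * b I \<alpha> u)"
      by (rule sum.mono_neutral_left) (auto simp: finite_mlen_le k' b_def)
    finally show ?thesis .
  qed
  ultimately show ?thesis
    unfolding smooth_1form_def coeffs_1form_def by (intro exI[of _ b]) auto
qed

lemma smooth_1form_S_multi:
  assumes "smooth_1form D k \<phi>" "line_open D" "1 \<le> k"
  shows "smooth_1form D k (S_multi k K \<phi>)"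
proof -
  have "smooth_1form D k (foldr (S_form k) is \<phi>)" for "is"
    by (induction "is") (simp_all add: assms smooth_1form_S_form)
  then show ?thesis
    by (simp add: S_multi_def)
qed


section \<open>The operator \<open>P\<close> on the differential of a homogeneous function\<close>

text \<open>The factor \<open>c\<close> makes room for the skew components of \<open>d\<Theta>\<^sub>0\<close>, which are constant multiples
  of \<open>dg\<close> at the points of \<open>D\<close>.\<close>

lemma P_scalar_homogeneous:
  fixes g :: "('m::{finite,linorder}, 'n::finite) coords \<Rightarrow> real"
  assumes D: "line_open D" and k: "1 \<le> k"
    and g: "\<And>p. Ck_coords D g p" "of_order k g"
    and hom1: "\<And>u i j. u \<in> D \<Longrightarrow>
      vec_apply k (Delta k (axis j 1) i u) g u = (if i = j then g u else 0)"
    and hom2: "\<And>u i K. u \<in> D \<Longrightarrow> 2 \<le> mlen K \<Longrightarrow> vec_apply k (Delta k K i u) g u = 0"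
    and \<phi>: "\<And>u v. u \<in> D \<Longrightarrow> \<phi> u [v] = c * vec_apply k v g u"
    and u: "u \<in> D"
  shows "P_scalar k 1 CARD('m) j \<phi> u [total_vec (2 * k - 1) i u] = (if i = j then c * g u else 0)"
proof -
  have "Ck_coords D (pderiv_coord I \<alpha> g) p" for I \<alpha> p
    using g(1)[of "Suc p"] by (simp add: Ck_coords_Suc_iff)
  then have "coeffs_1form D k (\<lambda>I \<alpha> u. c * pderiv_coord I \<alpha> g u) \<phi>"
    using of_order_pderiv_coord[OF g(2)] unfolding coeffs_1form_def
    by (auto simp: \<phi> vec_apply_def sum_distrib_left mult_ac of_order_def Ck_coords_const
        intro!: Ck_coords_mult[OF D])
  then have smooth: "smooth_1form D k (S_multi k K \<phi>)" for K
    by (intro smooth_1form_S_multi D k) (auto simp: smooth_1form_def)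
  have contr: "i_total k i (S_multi k K \<phi>) w [] = c * vec_apply k (Delta k K i w) g w"
    if "w \<in> D" for w K
    using that by (simp add: i_total_def contract_def S_multi_apply \<phi> Delta_def)
  have zero: "d_multi k J (S_multi k (J + axis j 1) \<phi>) u [total_vec (2 * k - 1) i u] = 0"
    if J: "J \<noteq> 0" "mlen J \<le> k - 1" for J
  proof -
    let ?\<psi> = "d_multi k J (S_multi k (J + axis j 1) \<phi>)"
    have "2 \<le> mlen (J + axis j 1)"
      using J(1) mlen_eq_0_iff[of J] by (simp add: mlen_add_axis)
    then have *: "smooth_1form D (k + mlen J) ?\<psi>" "i_total (k + mlen J) i ?\<psi> u [] = 0"
      using d_total_list_kills[OF D smooth, of i "J + axis j 1" "mword J"] u
      by (simp_all add: d_multi_def length_mword contr hom2)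
    \<comment> \<open>The sum in \<open>P\<close> stops at \<open>|J| = k - 1\<close>, hence \<open>k + |J| \<le> 2k - 1\<close>.\<close>
    have "?\<psi> u [total_vec (2 * k - 1) i u] = ?\<psi> u [total_vec (k + mlen J) i u]"
      using J(2) k by (intro smooth_1form_apply_cong[OF *(1) u]) (simp add: total_vec_def)
    then show ?thesis
      using *(2) by (simp add: i_total_def contract_def)
  qed
  have "S_multi k (axis j 1) \<phi> u [total_vec (2 * k - 1) i u] =
      i_total k i (S_multi k (axis j 1) \<phi>) u []"
    unfolding i_total_def contract_def
    using k by (intro smooth_1form_apply_cong[OF smooth u]) (simp add: total_vec_def)
  then have main: "d_multi k 0 (S_multi k (0 + axis j 1) \<phi>) u [total_vec (2 * k - 1) i u] =
      (if i = j then c * g u else 0)"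
    using length_mword[of "0 :: 'm mindex"] by (simp add: d_multi_def mlen_zero contr u hom1)
  have "P_scalar k 1 CARD('m) j \<phi> u [total_vec (2 * k - 1) i u] =
      (\<Sum>J :: 'm mindex | mlen J \<le> k - 1. if J = 0 then if i = j then c * g u else 0 else 0)"
    unfolding P_scalar_def
  proof (rule sum.cong)
    show "{J :: 'm mindex. mlen J \<le> 1 * k - 1} = {J. mlen J \<le> k - 1}"
      by simp
  next
    fix J :: "'m mindex"
    assume "J \<in> {J. mlen J \<le> k - 1}"
    then show "(- 1) ^ mlen J * fact (CARD('m) - CARD('m)) * fact (mlen J) /
        (real 1 ^ (mlen J + 1) * fact (CARD('m) - CARD('m) + mlen J + 1) * real (mfact J)) *
        d_multi k J (S_multi k (J + axis j 1) \<phi>) u [total_vec (2 * k - 1) i u] =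
        (if J = 0 then if i = j then c * g u else 0 else 0)"
      using zero[of J] main by (cases "J = 0") (simp_all add: mlen_zero mfact_def)
  qed
  then show ?thesis
    by (simp add: finite_mlen_le mlen_zero)
qed


section \<open>Exterior algebra\<close>

abbreviation axes :: "'m list \<Rightarrow> 'm::finite rvec list"
  where "axes js \<equiv> map (\<lambda>i. axis i 1) js"

lemma dt_wedge_permute:
  assumes "\<sigma> permutes {..<length is}"
  shows "dt_wedge (permute_list \<sigma> is) ws = of_int (sign \<sigma>) * dt_wedge is ws"
proof (cases "length ws = length is")
  case True
  let ?S = "{..<length is}"
  have perm: "permutation \<sigma>"
    using assms permutation_permutes by blast
  have "dt_wedge (permute_list \<sigma> is) ws =
      (\<Sum>\<pi> | \<pi> permutes ?S. of_int (sign \<pi>) * (\<Prod>a\<in>?S. (ws ! \<pi> a) $ (is ! \<sigma> a)))"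
    using True unfolding dt_wedge_def
    by (auto simp: permute_list_nth[OF assms] intro!: sum.cong prod.cong)
  also have "\<dots> = (\<Sum>\<pi> | \<pi> permutes ?S.
      of_int (sign (\<pi> \<circ> \<sigma>)) * (\<Prod>a\<in>?S. (ws ! (\<pi> \<circ> \<sigma>) a) $ (is ! \<sigma> a)))"
    by (rule sum_permutations_compose_right[OF assms])
  also have "\<dots> = (\<Sum>\<pi> | \<pi> permutes ?S.
      of_int (sign \<sigma>) * (of_int (sign \<pi>) * (\<Prod>a\<in>?S. (ws ! \<pi> a) $ (is ! a))))"
  proof (intro sum.cong refl)
    fix \<pi> assume "\<pi> \<in> {\<pi>. \<pi> permutes ?S}"
    then have "permutation \<pi>"
      using permutation_permutes by blast
    moreover have "(\<Prod>a\<in>?S. (ws ! \<pi> (\<sigma> a)) $ (is ! \<sigma> a)) = (\<Prod>a\<in>?S. (ws ! \<pi> a) $ (is ! a))"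
      using prod.permute[OF assms, of "\<lambda>a. (ws ! \<pi> a) $ (is ! a)"] by (simp add: o_def)
    ultimately show "of_int (sign (\<pi> \<circ> \<sigma>)) * (\<Prod>a\<in>?S. (ws ! (\<pi> \<circ> \<sigma>) a) $ (is ! \<sigma> a)) =
        of_int (sign \<sigma>) * (of_int (sign \<pi>) * (\<Prod>a\<in>?S. (ws ! \<pi> a) $ (is ! a)))"
      by (simp add: sign_compose perm)
  qed
  finally show ?thesis
    using True by (simp add: dt_wedge_def sum_distrib_left)
qed (simp add: dt_wedge_def)

lemma dt_wedge_axes:
  assumes "length js = length is"
  shows "dt_wedge is (axes js) =
    (\<Sum>\<pi> | \<pi> permutes {..<length is}. of_int (sign \<pi>) * (if permute_list \<pi> js = is then 1 else 0))"
proof -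
  have "(\<Prod>a<length is. (axes js ! \<pi> a) $ (is ! a)) = (if permute_list \<pi> js = is then 1 else 0)"
    if \<pi>: "\<pi> permutes {..<length is}" for \<pi>
  proof -
    have "\<pi> a < length is" if "a < length is" for a
      using permutes_in_image[OF \<pi>, of a] that by simp
    then have "(\<Prod>a<length is. (axes js ! \<pi> a) $ (is ! a)) =
        (\<Prod>a<length is. if js ! \<pi> a = is ! a then 1 else 0)"
      using assms by (auto simp: axis_def intro!: prod.cong)
    also have "\<dots> = (if \<forall>a<length is. js ! \<pi> a = is ! a then 1 else 0)"
      by (auto simp: prod_zero_iff)
    also have "(\<forall>a<length is. js ! \<pi> a = is ! a) \<longleftrightarrow> permute_list \<pi> js = is"
      using assms \<pi> by (auto simp: list_eq_iff_nth_eq permute_list_nth)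
    finally show ?thesis .
  qed
  then show ?thesis
    using assms by (simp add: dt_wedge_def)
qed

text \<open>Antisymmetrising an alternating form over its arguments multiplies it by \<open>s!\<close>: the lists
  that contribute are the rearrangements of \<open>is\<close>, and the sign with which \<open>dt_wedge\<close> reacts to
  a rearrangement is the one with which it occurs.\<close>

lemma sum_dt_wedge_axes:
  fixes "is" :: "'m::finite list"
  assumes "length is = s"
  shows "(\<Sum>js | length js = s. dt_wedge is (axes js) * dt_wedge js ws) = fact s * dt_wedge is ws"
proof -
  let ?P = "{\<pi>. \<pi> permutes {..<s}}"
  have fin: "finite {js :: 'm list. length js = s}"
    using finite_lists_length_eq[of "UNIV :: 'm set" s] by simp
  have inner: "(\<Sum>js | length js = s. (if permute_list \<pi> js = is then 1 else 0) * dt_wedge js ws) =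
      of_int (sign \<pi>) * dt_wedge is ws" if \<pi>: "\<pi> permutes {..<s}" for \<pi>
  proof -
    have inv: "inv \<pi> permutes {..<s}"
      by (rule permutes_inv[OF \<pi>])
    have "permute_list (inv \<pi>) (permute_list \<pi> js) = js" if "length js = s" for js :: "'m list"
      using permute_list_compose[of "inv \<pi>" js \<pi>] inv that permutes_inv_o(1)[OF \<pi>] by simp
    moreover have "permute_list \<pi> (permute_list (inv \<pi>) is) = is"
      using permute_list_compose[of \<pi> "is" "inv \<pi>"] \<pi> assms permutes_inv_o(2)[OF \<pi>] by simp
    ultimately have "permute_list \<pi> js = is \<longleftrightarrow> js = permute_list (inv \<pi>) is"
      if "length js = s" for js
      using that by metis
    then have "(\<Sum>js | length js = s. (if permute_list \<pi> js = is then 1 else 0) * dt_wedge js ws) =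
        (\<Sum>js | length js = s. if js = permute_list (inv \<pi>) is then dt_wedge js ws else 0)"
      by (intro sum.cong) auto
    also have "\<dots> = dt_wedge (permute_list (inv \<pi>) is) ws"
      using fin assms by simp
    also have "\<dots> = of_int (sign \<pi>) * dt_wedge is ws"
      using inv assms \<pi> permutation_permutes[of \<pi>]
      by (subst dt_wedge_permute) (auto simp: sign_inverse)
    finally show ?thesis .
  qed
  have "(\<Sum>js | length js = s. dt_wedge is (axes js) * dt_wedge js ws) =
      (\<Sum>js | length js = s. \<Sum>\<pi>\<in>?P.
        of_int (sign \<pi>) * ((if permute_list \<pi> js = is then 1 else 0) * dt_wedge js ws))"
    using assms by (auto simp: dt_wedge_axes sum_distrib_right mult.assoc intro!: sum.cong)
  also have "\<dots> = (\<Sum>\<pi>\<in>?P. of_int (sign \<pi>) *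
      (\<Sum>js | length js = s. (if permute_list \<pi> js = is then 1 else 0) * dt_wedge js ws))"
    by (subst sum.swap) (simp add: sum_distrib_left)
  also have "\<dots> = (\<Sum>\<pi>\<in>?P. dt_wedge is ws)"
    by (intro sum.cong refl)
      (simp add: inner mult.assoc[symmetric] of_int_mult[symmetric] del: of_int_mult)
  also have "\<dots> = fact s * dt_wedge is ws"
    by (simp add: card_permutations[of "{..<s}" s])
  finally show ?thesis .
qed

lemma sum_lists_Cons:
  fixes h :: "'m::finite list \<Rightarrow> real"
  shows "(\<Sum>is | length is = n. \<Sum>j\<in>UNIV. h (j # is)) = (\<Sum>js | length js = Suc n. h js)"
proof -
  have "(\<Sum>is | length is = n. \<Sum>j\<in>UNIV. h (j # is)) =
      (\<Sum>(is, j)\<in>{is. length is = n} \<times> UNIV. h (j # is))"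
    by (rule sum.cartesian_product)
  also have "\<dots> = (\<Sum>js | length js = Suc n. h js)"
    by (rule sum.reindex_bij_witness[of _ "\<lambda>js. (tl js, hd js)" "\<lambda>(is, j). j # is"])
      (auto simp: length_Suc_conv)
  finally show ?thesis .
qed


section \<open>The Lagrangian recovered from \<open>\<Theta>\<^sub>1\<close>\<close>

lemma ext_d_fun_apply:
  assumes "has_partials g u"
  shows "ext_d k (\<lambda>u vs. form_of_fun g u vs * b / e) u [v] = b / e * vec_apply k v g u"
  using vec_apply_mult[OF assms has_partials_const, of k v "b / e"]
  by (simp add: ext_d_def form_of_fun_def vec_apply_const)

lemma lie_d_fun:
  "lie_d k Y (form_of_fun g) u [] = vec_apply k (Y u) g u"
  by (simp add: lie_d_def contract_def ext_d_def form_of_fun_def)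

theorem theorem5p1:
  fixes X :: "'e topology" and A :: "('e, 'n::finite) chart set" and k :: nat
    and L :: "('m::{finite,linorder} rvec \<Rightarrow> 'e) set \<Rightarrow> real"
  assumes "smooth_manifold X A" and "k \<ge> 1"
    and "lagrangian X A k L" and "homogeneous X A k L"
  shows "eq_mod_const A (Theta0 X A k L)
    (\<lambda>c ws u vs. 1 / real CARD('m) * v_i_T (2 * k - 1) (CARD('m) - 1) (Theta1 X A k L c) ws u vs)"
  unfolding eq_mod_const_def
proof (intro exI[of _ "\<lambda>_. 0"] ballI allI)
  fix c ws and u :: "('m, 'n) coords"
  assume c: "c \<in> A" and u: "u \<in> coord_dom c"
  define D :: "('m, 'n) coords set" where "D = coord_dom c"
  define g :: "('m, 'n) coords \<Rightarrow> real" where "g = coord_expr X A k L c"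
  define W :: "'m rvec list \<Rightarrow> real" where "W = dt_wedge (sorted_list_of_set UNIV)"
  obtain n where n: "CARD('m) = Suc n"
    by (metis not0_implies_Suc zero_less_card_finite less_irrefl)
  have uD: "u \<in> D"
    using u by (simp add: D_def)
  have D: "line_open D"
    unfolding D_def using assms(1) c
    by (intro line_open_coord_dom) (auto simp: smooth_manifold_def)
  have g: "Ck_coords D g p" for p
    using assms(3) c by (simp add: lagrangian_def D_def g_def)
  have hp: "has_partials g w" if "w \<in> D" for w
    using g[of "Suc 0"] that by (simp add: Ck_coords_Suc_iff)
  have hom1: "vec_apply k (Delta k (axis j 1) i w) g w = (if i = j then g w else 0)"
    if "w \<in> D" for w i j
    using assms(4) c that unfolding homogeneous_def lie_d_fun D_def g_def by auto
  have hom2: "vec_apply k (Delta k K i w) g w = 0" if "w \<in> D" "2 \<le> mlen K" for w i K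
    using assms(4) c that unfolding homogeneous_def lie_d_fun D_def g_def by auto
  \<comment> \<open>The skew components of \<open>d\<^sup>mt\<close>.\<close>
  define b where "b is = W (axes is) / fact CARD('m)" for "is"
  have W: "(\<Sum>js | length js = CARD('m). W (axes js) * dt_wedge js ws') = fact CARD('m) * W ws'" for ws'
    unfolding W_def by (rule sum_dt_wedge_axes) simp
  have comp: "vcomp CARD('m) (v_d k CARD('m) (Theta0 X A k L c)) is w [v] =
      b is * vec_apply k v g w" if "w \<in> D" for "is" w v
  proof -
    have "v_d k CARD('m) (Theta0 X A k L c) ws' w [v] = W ws' * vec_apply k v g w" for ws'
    proof -
      have "v_d k CARD('m) (Theta0 X A k L c) ws' w [v] =
          (\<Sum>js | length js = CARD('m). W (axes js) / fact CARD('m) * vec_apply k v g w * dt_wedge js ws')"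
        unfolding v_d_def vcomp_def Theta0_def W_def[symmetric] g_def[symmetric]
          ext_d_fun_apply[OF hp[OF that]] ..
      also have "\<dots> = (\<Sum>js | length js = CARD('m). W (axes js) * dt_wedge js ws') *
          vec_apply k v g w / fact CARD('m)"
        unfolding sum_distrib_right sum_divide_distrib by (simp add: mult_ac)
      finally show ?thesis
        by (simp add: W)
    qed
    then show ?thesis
      by (simp add: vcomp_def b_def)
  qed
  have Theta1: "Theta1 X A k L c ws' u [total_vec (2 * k - 1) i u] = g u * W (axis i 1 # ws')" for i ws'
  proof -
    have "Theta1 X A k L c ws' u [total_vec (2 * k - 1) i u] =
        (\<Sum>is | length is = CARD('m). \<Sum>j\<in>UNIV.
          (if i = j then b is * g u else 0) * dt_wedge is (axis j 1 # ws'))"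
      unfolding Theta1_def v_P_def
      by (intro sum.cong refl arg_cong2[where f = "(*)"]
          P_scalar_homogeneous[OF D assms(2) g of_order_coord_expr[of k X A L c, folded g_def]
            hom1 hom2 comp uD])
    also have "\<dots> = (\<Sum>is | length is = CARD('m). b is * g u * dt_wedge is (axis i 1 # ws'))"
      by (simp add: if_distrib[of "\<lambda>x. x * _"] cong: if_cong)
    also have "\<dots> = (\<Sum>is | length is = CARD('m). W (axes is) * dt_wedge is (axis i 1 # ws')) *
        g u / fact CARD('m)"
      unfolding sum_distrib_right sum_divide_distrib by (simp add: b_def mult_ac)
    finally show ?thesis
      by (simp add: W)
  qed
  have "v_i_T (2 * k - 1) (CARD('m) - 1) (Theta1 X A k L c) ws u [] =
      (\<Sum>is | length is = n. \<Sum>j\<in>UNIV. g u / fact n * (W (axes (j # is)) * dt_wedge (j # is) ws))"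
    by (simp add: v_i_T_def i_total_def contract_def vcomp_def n Theta1 mult.assoc)
  also have "\<dots> = g u / fact n * (\<Sum>js | length js = CARD('m). W (axes js) * dt_wedge js ws)"
    by (simp only: sum_lists_Cons[where h = "\<lambda>js. g u / fact n * (W (axes js) * dt_wedge js ws)"]
        n sum_distrib_left)
  also have "\<dots> = real CARD('m) * (g u * W ws)"
    unfolding W by (simp add: n)
  finally show "Theta0 X A k L c ws u [] = 1 / real CARD('m) *
      v_i_T (2 * k - 1) (CARD('m) - 1) (Theta1 X A k L c) ws u [] + 0"
    by (simp add: Theta0_def W_def g_def form_of_fun_def)
qed

end
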